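(* Let $\alpha,\beta,r$ be complex numbers with $\beta\ne0$ and let $n\ge0$ be an integer. For $|x|<1$, $$\sum_{k=1}^{\infty}\zeta(k+1)\,(r+k\beta\mid\alpha)_{n}\,x^{k}=-(r\mid\alpha)_{n}\left(\psi(1-x)+\gamma\right)+\sum_{k=1}^{n}S(n,k;\alpha,\beta,r)\,k!\,\zeta(k+1,1-x)\,(\beta x)^{k}.$$
   Context: $\zeta(s)$ is the Riemann zeta function, $\zeta(s,a)=\sum_{j\ge0}(j+a)^{-s}$ the Hurwitz zeta function, $\psi=\Gamma'/\Gamma$ the digamma function and $\gamma$ Euler's constant. The generalized factorial with increment $\alpha$ is $(z\mid\alpha)_0=1$, $(z\mid\alpha)_n=z(z-\alpha)\cdots(z-n\alpha+\alpha)$. The generalized Stirling numbers $S(n,k;\alpha,\beta,r)$ are characterised by: for every $n$-times differentiable $f$ on $(0,\infty)$, with $D=d/dx$, $$\left(\beta x^{1-\alpha/\beta}D\right)^{n}\left[x^{r/\beta}f(x)\right]=x^{(r-n\alpha)/\beta}\sum_{k=0}^{n}S(n,k;\alpha,\beta,r)\beta^{k}x^{k}f^{(k)}(x);$$ equivalently, by the formal power series identity $$\left(\frac{(1+\alpha t)^{\beta/\alpha}-1}{\beta}\right)^{k}(1+\alpha t)^{r/\alpha}=k!\sum_{n=0}^{\infty}S(n,k;\alpha,\beta,r)\frac{t^{n}}{n!},$$ where $(1+\alpha t)^{c/\alpha}$ is interpreted as $e^{ct}$ when $\alpha=0$. *)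

theory Defs
  imports "HOL-Analysis.Analysis"
begin

text \<open>
  The two zeta functions are given by their Dirichlet series, which converge and represent them
  for \<open>Re s > 1\<close>; only the values at \<open>s = 2, 3, \<dots>\<close> are used. No analytic continuation is
  intended. The powers are principal ones; at integers \<open>s\<close> they are ordinary powers.
\<close>

definition riemann_zeta :: "complex \<Rightarrow> complex" where
  "riemann_zeta s = (\<Sum>j. of_nat (Suc j) powr (-s))"

definition hurwitz_zeta :: "complex \<Rightarrow> complex \<Rightarrow> complex" where
  "hurwitz_zeta s a = (\<Sum>j. (of_nat j + a) powr (-s))"

definition gen_factorial :: "complex \<Rightarrow> complex \<Rightarrow> nat \<Rightarrow> complex" where
  "gen_factorial z \<alpha> n = (\<Prod>i<n. z - of_nat i * \<alpha>)"

text \<open>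
  The formal power series \<open>(1 + \<alpha> t) ^ (c / \<alpha>)\<close>, read as \<open>exp (c t)\<close> for \<open>\<alpha> = 0\<close>.
\<close>

definition fps_gen_exp :: "complex \<Rightarrow> complex \<Rightarrow> complex fps" where
  "fps_gen_exp \<alpha> c =
     (if \<alpha> = 0 then fps_exp c else fps_binomial (c / \<alpha>) oo (fps_const \<alpha> * fps_X))"

text \<open>
  The generalized Stirling numbers \<open>S(n, k; \<alpha>, \<beta>, r)\<close> for \<open>\<beta> \<noteq> 0\<close>, read off from
  their exponential generating function in \<open>n\<close>. That they are the coefficients in the expansion
  of the iterated differential operator is the lemma \<open>gen_stirling_operator\<close> below.
\<close>

definition gen_stirling ::
    "nat \<Rightarrow> nat \<Rightarrow> complex \<Rightarrow> complex \<Rightarrow> complex \<Rightarrow> complex" where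
  "gen_stirling n k \<alpha> \<beta> r =
     fact n / fact k *
     fps_nth ((fps_const (1 / \<beta>) * (fps_gen_exp \<alpha> \<beta> - 1)) ^ k * fps_gen_exp \<alpha> r) n"

lemma gen_stirling_gf:
  "(fps_const (1 / \<beta>) * (fps_gen_exp \<alpha> \<beta> - 1)) ^ k * fps_gen_exp \<alpha> r =
     fps_const (fact k) * Abs_fps (\<lambda>n. gen_stirling n k \<alpha> \<beta> r / fact n)"
  by (simp add: fps_eq_iff gen_stirling_def)

lemma fps_gen_exp_nth_0: "fps_nth (fps_gen_exp \<alpha> c) 0 = 1"
  by (simp add: fps_gen_exp_def)

lemma fps_gen_exp_deriv:
  "(1 + fps_const \<alpha> * fps_X) * fps_deriv (fps_gen_exp \<alpha> c) = fps_const c * fps_gen_exp \<alpha> c"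
proof (rule fps_ext)
  fix n
  show "fps_nth ((1 + fps_const \<alpha> * fps_X) * fps_deriv (fps_gen_exp \<alpha> c)) n =
          fps_nth (fps_const c * fps_gen_exp \<alpha> c) n"
  proof (cases "\<alpha> = 0")
    case True
    then show ?thesis by (simp add: fps_gen_exp_def)
  next
    case False
    have *: "of_nat (Suc m) * (a gchoose Suc m) = (a - of_nat m) * (a gchoose m)"
      for m and a :: complex
      using gbinomial_mult_1[of a m] by (simp add: algebra_simps)
    show ?thesis
    proof (cases n)
      case 0
      then show ?thesis using False
        by (simp add: fps_gen_exp_def fps_compose_linear distrib_right mult.assoc)
    next
      case (Suc m)
      have "fps_nth ((1 + fps_const \<alpha> * fps_X) * fps_deriv (fps_gen_exp \<alpha> c)) n =
          \<alpha> ^ Suc n * (of_nat (Suc n) * ((c / \<alpha>) gchoose Suc n)) +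
          \<alpha> * of_nat n * \<alpha> ^ n * ((c / \<alpha>) gchoose n)"
        using False Suc
        by (simp add: fps_gen_exp_def fps_compose_linear distrib_right mult.assoc
              del: of_nat_Suc power_Suc)
      also have "\<dots> = c * (\<alpha> ^ n * ((c / \<alpha>) gchoose n))"
        unfolding * using False by (simp add: field_simps)
      finally show ?thesis
        using False by (simp add: fps_gen_exp_def fps_compose_linear)
    qed
  qed
qed

lemma gen_stirling_0: "gen_stirling 0 k \<alpha> \<beta> r = (if k = 0 then 1 else 0)"
  by (simp add: gen_stirling_def fps_gen_exp_nth_0 fps_nth_power_0)

lemma gen_stirling_Suc:
  assumes "\<beta> \<noteq> 0"
  shows "gen_stirling (Suc n) k \<alpha> \<beta> r =
           (r - of_nat n * \<alpha> + of_nat k * \<beta>) * gen_stirling n k \<alpha> \<beta> r +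
           (if k = 0 then 0 else gen_stirling n (k - 1) \<alpha> \<beta> r)"
proof -
  define L where "L = 1 + fps_const \<alpha> * fps_X"
  define B where "B = fps_const (1 / \<beta>) * (fps_gen_exp \<alpha> \<beta> - 1)"
  define E where "E = fps_gen_exp \<alpha> r"
  define G where "G k = B ^ k * E" for k
  have dE: "L * fps_deriv E = fps_const r * E"
    unfolding L_def E_def by (rule fps_gen_exp_deriv)
  have c1: "fps_const (1 / \<beta>) * fps_const \<beta> = 1"
    using assms by simp
  have "L * fps_deriv B = fps_const (1 / \<beta>) * (L * fps_deriv (fps_gen_exp \<alpha> \<beta>))"
    by (simp add: B_def)
  also have "\<dots> = (fps_const (1 / \<beta>) * fps_const \<beta>) * fps_gen_exp \<alpha> \<beta>"
    unfolding L_def fps_gen_exp_deriv by (simp only: mult.assoc)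
  also have "\<dots> = fps_const \<beta> * B + 1"
    unfolding B_def mult.assoc[symmetric] using c1 by (simp add: mult.commute)
  finally have dB: "L * fps_deriv B = fps_const \<beta> * B + 1" .
  have dG: "L * fps_deriv (G k) = fps_const (r + of_nat k * \<beta>) * G k +
      (if k = 0 then 0 else fps_const (of_nat k) * G (k - 1))"
  proof (cases k)
    case 0
    then show ?thesis using dE by (simp add: G_def)
  next
    case (Suc m)
    have "L * fps_deriv (G k) =
        fps_const (of_nat k) * (L * fps_deriv B) * B ^ m * E + B ^ k * (L * fps_deriv E)"
      unfolding G_def by (simp add: fps_deriv_power Suc algebra_simps del: of_nat_Suc power_Suc)
    also have "\<dots> = fps_const (r + of_nat k * \<beta>) * G k + fps_const (of_nat k) * G m"
      unfolding dB dE G_def Suc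
      by (simp add: algebra_simps del: of_nat_Suc fps_const_add fps_const_mult
            add: fps_const_add[symmetric] fps_const_mult[symmetric])
    finally show ?thesis using Suc by simp
  qed
  have S: "gen_stirling n k \<alpha> \<beta> r = fact n / fact k * fps_nth (G k) n" for n k
    by (simp add: gen_stirling_def G_def B_def E_def)
  have "fps_nth (L * fps_deriv (G k)) n =
      of_nat (Suc n) * fps_nth (G k) (Suc n) + of_nat n * \<alpha> * fps_nth (G k) n"
    unfolding L_def by (cases n) (simp_all add: distrib_right mult.assoc, simp add: algebra_simps)
  then have co: "of_nat (Suc n) * fps_nth (G k) (Suc n) =
      (r - of_nat n * \<alpha> + of_nat k * \<beta>) * fps_nth (G k) n +
      (if k = 0 then 0 else of_nat k * fps_nth (G (k - 1)) n)"
    unfolding dG by (simp add: algebra_simps split: if_splits)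
  have "gen_stirling (Suc n) k \<alpha> \<beta> r =
      fact n / fact k * (of_nat (Suc n) * fps_nth (G k) (Suc n))"
    unfolding S by simp
  also have "\<dots> = (r - of_nat n * \<alpha> + of_nat k * \<beta>) * gen_stirling n k \<alpha> \<beta> r +
           (if k = 0 then 0 else gen_stirling n (k - 1) \<alpha> \<beta> r)"
  proof -
    have "fact n / fact k * (of_nat k * y) = fact n / fact (k - 1) * y" if "k \<noteq> 0"
      for y :: complex
      using that by (simp add: fact_reduce[of k] divide_simps)
    then have "fact n / fact k * (if k = 0 then 0 else of_nat k * fps_nth (G (k - 1)) n) =
        (if k = 0 then 0 else fact n / fact (k - 1) * fps_nth (G (k - 1)) n)"
      by simp
    then show ?thesis unfolding co S distrib_left by (simp only: mult.left_commute)
  qed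
  finally show ?thesis .
qed

lemma gen_stirling_eq_0: "n < k \<Longrightarrow> \<beta> \<noteq> 0 \<Longrightarrow> gen_stirling n k \<alpha> \<beta> r = 0"
proof (induction n arbitrary: k)
  case 0
  then show ?case by (simp add: gen_stirling_0)
next
  case (Suc n)
  then show ?case by (simp add: gen_stirling_Suc)
qed

definition nth_deriv :: "nat \<Rightarrow> (real \<Rightarrow> complex) \<Rightarrow> real \<Rightarrow> complex" where
  "nth_deriv n = (\<lambda>g x. vector_derivative g (at x)) ^^ n"

definition stirling_operator ::
    "complex \<Rightarrow> complex \<Rightarrow> (real \<Rightarrow> complex) \<Rightarrow> real \<Rightarrow> complex" where
  "stirling_operator \<alpha> \<beta> g =
     (\<lambda>x. \<beta> * of_real x powr (1 - \<alpha> / \<beta>) * vector_derivative g (at x))"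

lemma has_vector_derivative_of_real_powr:
  assumes "x > 0"
  shows "((\<lambda>y. complex_of_real y powr s) has_vector_derivative
            s * of_real x powr (s - 1)) (at x)"
proof -
  have "complex_of_real x \<notin> \<real>\<^sub>\<le>\<^sub>0" using assms by (simp add: complex_nonpos_Reals_iff)
  from has_field_derivative_powr[OF this, of s] show ?thesis
    by (rule has_vector_derivative_real_field)
qed

lemma gen_stirling_operator:
  assumes "\<beta> \<noteq> 0"
    and "\<And>k x. k < n \<Longrightarrow> x > 0 \<Longrightarrow> nth_deriv k f differentiable (at x)"
    and "x > 0"
  shows "(stirling_operator \<alpha> \<beta> ^^ n) (\<lambda>x. of_real x powr (r / \<beta>) * f x) x =
           of_real x powr ((r - of_nat n * \<alpha>) / \<beta>) *
           (\<Sum>k\<le>n. gen_stirling n k \<alpha> \<beta> r * \<beta> ^ k * of_real x ^ k * nth_deriv k f x)"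
  using assms(2,3)
proof (induction n arbitrary: x)
  case 0
  then show ?case by (simp add: gen_stirling_0 nth_deriv_def)
next
  case (Suc n)
  let ?S = "\<lambda>n k. gen_stirling n k \<alpha> \<beta> r"
  define s where "s = (r - of_nat n * \<alpha>) / \<beta>"
  define X where "X = complex_of_real x"
  have X0: "X \<noteq> 0" using Suc.prems by (simp add: X_def)
  define h where "h = (\<lambda>x. complex_of_real x powr s *
      (\<Sum>k\<le>n. ?S n k * \<beta> ^ k * of_real x ^ k * nth_deriv k f x))"
  have IH: "(stirling_operator \<alpha> \<beta> ^^ n) (\<lambda>x. of_real x powr (r / \<beta>) * f x) y = h y"
    if "y > 0" for y
    unfolding h_def s_def using Suc.prems(1) that by (intro Suc.IH) auto
  have dF: "(nth_deriv k f has_vector_derivative nth_deriv (Suc k) f x) (at x)" if "k \<le> n" for k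
    using Suc.prems(1)[of k x] Suc.prems(2) that
    by (simp add: nth_deriv_def flip: vector_derivative_works)
  have dpow: "((\<lambda>y. complex_of_real y ^ k) has_vector_derivative of_nat k * X ^ (k - 1)) (at x)"
    for k
    unfolding X_def by (rule has_vector_derivative_real_field) (auto intro!: derivative_eq_intros)
  have dsum: "((\<lambda>x. \<Sum>k\<le>n. ?S n k * \<beta> ^ k * of_real x ^ k * nth_deriv k f x)
      has_vector_derivative
        (\<Sum>k\<le>n. ?S n k * \<beta> ^ k *
          (X ^ k * nth_deriv (Suc k) f x + of_nat k * X ^ (k - 1) * nth_deriv k f x))) (at x)"
    unfolding mult.assoc
    by (intro has_vector_derivative_sum has_vector_derivative_mult_right)
      (use has_vector_derivative_mult[OF dpow dF] in \<open>simp add: X_def mult.assoc\<close>)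
  have dh: "(h has_vector_derivative
      (X powr s * (\<Sum>k\<le>n. ?S n k * \<beta> ^ k *
          (X ^ k * nth_deriv (Suc k) f x + of_nat k * X ^ (k - 1) * nth_deriv k f x)) +
       s * X powr (s - 1) * (\<Sum>k\<le>n. ?S n k * \<beta> ^ k * X ^ k * nth_deriv k f x))) (at x)"
    using has_vector_derivative_mult[OF has_vector_derivative_of_real_powr[OF Suc.prems(2)] dsum]
    unfolding h_def X_def .
  have "((stirling_operator \<alpha> \<beta> ^^ n) (\<lambda>x. of_real x powr (r / \<beta>) * f x)
      has_vector_derivative
      (X powr s * (\<Sum>k\<le>n. ?S n k * \<beta> ^ k *
          (X ^ k * nth_deriv (Suc k) f x + of_nat k * X ^ (k - 1) * nth_deriv k f x)) +
       s * X powr (s - 1) * (\<Sum>k\<le>n. ?S n k * \<beta> ^ k * X ^ k * nth_deriv k f x))) (at x)"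
    by (rule has_vector_derivative_transform_within_open[OF dh, of "{0<..}"])
      (use Suc.prems(2) IH in auto)
  then have "(stirling_operator \<alpha> \<beta> ^^ Suc n) (\<lambda>x. of_real x powr (r / \<beta>) * f x) x =
      \<beta> * X powr (1 - \<alpha> / \<beta>) *
      (X powr s * (\<Sum>k\<le>n. ?S n k * \<beta> ^ k *
          (X ^ k * nth_deriv (Suc k) f x + of_nat k * X ^ (k - 1) * nth_deriv k f x)) +
       s * X powr (s - 1) * (\<Sum>k\<le>n. ?S n k * \<beta> ^ k * X ^ k * nth_deriv k f x))"
    by (simp add: stirling_operator_def vector_derivative_at X_def)
  also have "\<dots> = \<beta> * (X powr (1 - \<alpha> / \<beta>) * X powr (s - 1)) *
      (\<Sum>k\<le>n. ?S n k * \<beta> ^ k *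
          (X ^ Suc k * nth_deriv (Suc k) f x + (of_nat k + s) * X ^ k * nth_deriv k f x))"
  proof -
    have p: "X powr s = X powr (s - 1) * X"
      using X0 by (simp add: powr_diff)
    have q: "X * (of_nat k * X ^ (k - 1)) = of_nat k * X ^ k" for k
      by (cases k) simp_all
    have "X powr s * (\<Sum>k\<le>n. ?S n k * \<beta> ^ k *
          (X ^ k * nth_deriv (Suc k) f x + of_nat k * X ^ (k - 1) * nth_deriv k f x)) =
        X powr (s - 1) * (\<Sum>k\<le>n. ?S n k * \<beta> ^ k *
          (X ^ Suc k * nth_deriv (Suc k) f x +
           (X * (of_nat k * X ^ (k - 1))) * nth_deriv k f x))"
      unfolding p mult.assoc sum_distrib_left by (intro sum.cong refl) (simp add: algebra_simps)
    then show ?thesis unfolding q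
      by (simp add: sum_distrib_left sum.distrib algebra_simps)
  qed
  also have "X powr (1 - \<alpha> / \<beta>) * X powr (s - 1) = X powr ((r - of_nat (Suc n) * \<alpha>) / \<beta>)"
    unfolding powr_add[symmetric] s_def using assms(1) by (intro arg_cong2[of _ _ _ _ "(powr)"])
      (simp_all add: field_simps)
  also have "\<beta> * X powr ((r - of_nat (Suc n) * \<alpha>) / \<beta>) *
      (\<Sum>k\<le>n. ?S n k * \<beta> ^ k *
          (X ^ Suc k * nth_deriv (Suc k) f x + (of_nat k + s) * X ^ k * nth_deriv k f x)) =
      X powr ((r - of_nat (Suc n) * \<alpha>) / \<beta>) *
      ((\<Sum>k\<le>n. ?S n k * \<beta> ^ Suc k * X ^ Suc k * nth_deriv (Suc k) f x) +
       (\<Sum>k\<le>n. (\<beta> * (of_nat k + s)) * ?S n k * \<beta> ^ k * X ^ k * nth_deriv k f x))"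
    by (simp add: sum_distrib_left sum.distrib algebra_simps)
  also have "(\<Sum>k\<le>n. (\<beta> * (of_nat k + s)) * ?S n k * \<beta> ^ k * X ^ k * nth_deriv k f x) =
      (\<Sum>k\<le>Suc n. (r - of_nat n * \<alpha> + of_nat k * \<beta>) * ?S n k * \<beta> ^ k * X ^ k * nth_deriv k f x)"
    using assms(1) by (simp add: gen_stirling_eq_0 s_def distrib_left add.commute mult.commute)
  also have "(\<Sum>k\<le>n. ?S n k * \<beta> ^ Suc k * X ^ Suc k * nth_deriv (Suc k) f x) =
      (\<Sum>k\<le>Suc n. (if k = 0 then 0 else ?S n (k - 1)) * \<beta> ^ k * X ^ k * nth_deriv k f x)"
    by (subst sum.atMost_Suc_shift) simp
  also have "\<dots> + (\<Sum>k\<le>Suc n. (r - of_nat n * \<alpha> + of_nat k * \<beta>) * ?S n k * \<beta> ^ k * X ^ k *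
        nth_deriv k f x) =
      (\<Sum>k\<le>Suc n. ?S (Suc n) k * \<beta> ^ k * X ^ k * nth_deriv k f x)"
    unfolding gen_stirling_Suc[OF assms(1)] sum.distrib[symmetric]
    by (intro sum.cong refl) (simp add: distrib_right)
  finally show ?case unfolding X_def .
qed

end

theory Submission
  imports Defs "HOL-Complex_Analysis.Cauchy_Integral_Formula"
begin

text \<open>
  Expand \<open>(r + k \<beta> | \<alpha>)\<^sub>n\<close> in the binomial coefficients \<open>k choose j\<close>; its coordinates are
  \<open>S(n, j; \<alpha>, \<beta>, r) \<beta>\<^sup>j j!\<close>. By linearity it remains to sum \<open>\<zeta>(k + 1) (k choose j) x\<^sup>k\<close> over
  \<open>k\<close>, and this is the Taylor series at \<open>1\<close> of the \<open>j\<close>-th polygamma function evaluated at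
  \<open>1 - x\<close>, because the polygamma values at \<open>1\<close> are zeta values and those at \<open>1 - x\<close> are Hurwitz
  zeta values.
\<close>

text \<open>Needed for the coefficient of the digamma term: at lower index 0 the Stirling recurrence
  is that of the falling product.\<close>

lemma gen_stirling_k_0:
  assumes "\<beta> \<noteq> 0"
  shows "gen_stirling n 0 \<alpha> \<beta> r = gen_factorial r \<alpha> n"
proof (induction n)
  case 0
  show ?case by (simp add: gen_stirling_0 gen_factorial_def)
next
  case (Suc n)
  then show ?case
    using assms by (simp add: gen_stirling_Suc gen_factorial_def mult.commute)
qed

text \<open>Induction on \<open>n\<close>: for each \<open>j\<close> the new factor splits as
  \<open>(r - n \<alpha> + j \<beta>) + \<beta> (k - j)\<close>. The first part keeps the index
  \<open>j\<close>, the second raises it to \<open>j + 1\<close>, which is the recurrence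
  \<open>gen_stirling_Suc\<close>.\<close>

lemma gen_factorial_eq_sum_binomial:
  assumes "\<beta> \<noteq> 0"
  shows "gen_factorial (r + of_nat k * \<beta>) \<alpha> n =
           (\<Sum>j\<le>n. gen_stirling n j \<alpha> \<beta> r * \<beta> ^ j * fact j * of_nat (k choose j))"
proof (induction n)
  case 0
  show ?case by (simp add: gen_stirling_0 gen_factorial_def)
next
  case (Suc n)
  let ?S = "\<lambda>n j. gen_stirling n j \<alpha> \<beta> r"
  define b where "b j = \<beta> ^ j * fact j * complex_of_nat (k choose j)" for j
  have b_Suc: "b (Suc j) = \<beta> * (of_nat k - of_nat j) * b j" for j
  proof -
    have "of_nat (Suc j) * complex_of_nat (k choose Suc j) =
        (of_nat k - of_nat j) * of_nat (k choose j)"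
      using gbinomial_mult_1[of "of_nat k :: complex" j]
      by (simp add: binomial_gbinomial algebra_simps)
    then show ?thesis
      by (simp add: b_def mult_ac)
  qed
  have "gen_factorial (r + of_nat k * \<beta>) \<alpha> (Suc n) =
      (r + of_nat k * \<beta> - of_nat n * \<alpha>) * (\<Sum>j\<le>n. ?S n j * b j)"
    using Suc.IH by (simp add: gen_factorial_def b_def mult_ac)
  also have "\<dots> = (\<Sum>j\<le>n. (r - of_nat n * \<alpha> + of_nat j * \<beta>) * ?S n j * b j) +
      (\<Sum>j\<le>n. ?S n j * b (Suc j))"
    unfolding sum_distrib_left sum.distrib[symmetric] b_Suc
    by (intro sum.cong refl) (simp add: algebra_simps)
  \<comment> \<open>The added term \<open>j = Suc n\<close> vanishes, since its lower index exceeds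
    \<open>n\<close>.\<close>
  also have "(\<Sum>j\<le>n. (r - of_nat n * \<alpha> + of_nat j * \<beta>) * ?S n j * b j) =
      (\<Sum>j\<le>Suc n. (r - of_nat n * \<alpha> + of_nat j * \<beta>) * ?S n j * b j)"
    using assms by (simp add: gen_stirling_eq_0)
  also have "(\<Sum>j\<le>n. ?S n j * b (Suc j)) =
      (\<Sum>j\<le>Suc n. (if j = 0 then 0 else ?S n (j - 1)) * b j)"
    by (subst sum.atMost_Suc_shift) simp
  also have "(\<Sum>j\<le>Suc n. (r - of_nat n * \<alpha> + of_nat j * \<beta>) * ?S n j * b j) + \<dots> =
      (\<Sum>j\<le>Suc n. ?S (Suc n) j * b j)"
    unfolding gen_stirling_Suc[OF assms] sum.distrib[symmetric]
    by (intro sum.cong refl) (simp add: distrib_right)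
  finally show ?case
    by (simp only: b_def mult.assoc)
qed

lemma hurwitz_zeta_eq_Polygamma:
  assumes "a \<notin> \<int>\<^sub>\<le>\<^sub>0" and "k > 0"
  shows "hurwitz_zeta (of_nat k + 1) a = (-1) ^ Suc k * Polygamma k a / fact k"
proof -
  have nz: "of_nat j + a \<noteq> 0" for j
    using assms(1) by (metis add.commute plus_of_nat_eq_0_imp)
  have "(of_nat j + a) powr (- (of_nat k + 1)) = inverse ((a + of_nat j) ^ Suc k)" for j
  proof -
    have "(of_nat j + a) powr (of_nat k + 1) = (of_nat j + a) powr of_nat (Suc k)"
      by (simp add: add.commute)
    also have "\<dots> = (a + of_nat j) ^ Suc k"
      using nz[of j] by (subst powr_nat) (simp add: add.commute)
    finally show ?thesis
      by (simp only: powr_minus)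
  qed
  then show ?thesis
    using Polygamma_LIMSEQ[OF _ assms(2), of a] nz[of 0] by (simp add: hurwitz_zeta_def sums_iff)
qed

lemma riemann_zeta_eq_hurwitz_zeta: "riemann_zeta s = hurwitz_zeta s 1"
  by (simp add: riemann_zeta_def hurwitz_zeta_def add.commute)

lemma one_minus_notin_nonpos_Ints:
  assumes "norm (x :: complex) < 1"
  shows "1 - x \<notin> \<int>\<^sub>\<le>\<^sub>0"
proof
  assume "1 - x \<in> \<int>\<^sub>\<le>\<^sub>0"
  then obtain m where "1 - x = of_int m" "m \<le> 0"
    by (elim nonpos_Ints_cases)
  then have "Re (1 - x) \<le> 0"
    by (metis Re_complex_of_real of_int_0_le_iff of_int_le_0_iff of_real_of_int_eq)
  then show False
    using assms complex_Re_le_cmod[of x] by simp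
qed

text \<open>Taylor expansion about 1: the unit disc there avoids the poles, and differentiating
  raises the polygamma order.\<close>

lemma Polygamma_power_series:
  assumes "norm (x :: complex) < 1"
  shows "(\<lambda>k. Polygamma (j + k) 1 / fact k * (- x) ^ k) sums Polygamma j (1 - x)"
proof -
  have "Polygamma j holomorphic_on ball (1 :: complex) 1"
  proof (rule holomorphic_onI)
    fix z :: complex
    assume "z \<in> ball 1 1"
    then have "z \<notin> \<int>\<^sub>\<le>\<^sub>0"
      using one_minus_notin_nonpos_Ints[of "1 - z"] by (simp add: dist_norm)
    then show "Polygamma j field_differentiable at z within ball 1 1"
      using has_field_derivative_Polygamma field_differentiable_def by blast
  qed
  from holomorphic_power_series[OF this, of "1 - x"] assms show ?thesis
    by (simp add: dist_norm higher_deriv_Polygamma)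
qed

text \<open>Equals \<open>\<zeta>(k + 1)\<close> for \<open>k > 0\<close>; at \<open>k = 0\<close>,
  where zeta has its pole, the value is Euler's constant.\<close>

definition zeta_coeff :: "nat \<Rightarrow> complex" where
  "zeta_coeff k = (-1) ^ Suc k * Polygamma k 1 / fact k"

lemma zeta_coeff_Suc: "zeta_coeff (Suc k) = riemann_zeta (of_nat (Suc k) + 1)"
  unfolding zeta_coeff_def riemann_zeta_eq_hurwitz_zeta
  by (rule hurwitz_zeta_eq_Polygamma[symmetric]) simp_all

text \<open>With \<open>k = i + j\<close> the binomial turns \<open>1 / (i + j)!\<close> into
  \<open>1 / (i! j!)\<close>, leaving the Taylor series of \<open>Polygamma j\<close> in
  \<open>- x\<close>.\<close>

lemma zeta_coeff_binomial_sums: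
  assumes "norm x < 1"
  shows "(\<lambda>k. zeta_coeff k * of_nat (k choose j) * x ^ k) sums
           (x ^ j * ((-1) ^ Suc j * Polygamma j (1 - x) / fact j))"
proof -
  have "zeta_coeff (i + j) * of_nat ((i + j) choose j) * x ^ (i + j) =
      x ^ j * (-1) ^ Suc j / fact j * (Polygamma (j + i) 1 / fact i * (- x) ^ i)" for i
  proof -
    have "complex_of_nat ((i + j) choose j) = fact (i + j) / (fact j * fact i)"
      by (subst binomial_fact) simp_all
    then show ?thesis
      by (simp add: zeta_coeff_def power_add power_minus[of x] add.commute)
  qed
  then have "(\<lambda>i. zeta_coeff (i + j) * of_nat ((i + j) choose j) * x ^ (i + j)) sums
      (x ^ j * (-1) ^ Suc j / fact j * Polygamma j (1 - x))"
    using sums_mult[OF Polygamma_power_series[OF assms]] by presburger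
  \<comment> \<open>The terms with \<open>k < j\<close> have binomial coefficient zero, so the shift
    by \<open>j\<close> loses nothing.\<close>
  then show ?thesis
    by (subst (asm) sums_zero_iff_shift) (simp_all add: binomial_eq_0 mult_ac)
qed

text \<open>Removing the term \<open>k = 0\<close> changes the sum only for \<open>j = 0\<close>,
  where it subtracts Euler's constant.\<close>

lemma riemann_zeta_binomial_sums:
  assumes "norm x < 1"
  shows "(\<lambda>k. riemann_zeta (of_nat (Suc k) + 1) * of_nat (Suc k choose j) * x ^ Suc k) sums
           (if j = 0 then - (Digamma (1 - x) + euler_mascheroni)
            else x ^ j * hurwitz_zeta (of_nat j + 1) (1 - x))"
proof -
  have "(\<lambda>k. zeta_coeff (Suc k) * of_nat (Suc k choose j) * x ^ Suc k) sums
      (x ^ j * ((-1) ^ Suc j * Polygamma j (1 - x) / fact j) - zeta_coeff 0 * of_nat (0 choose j))"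
    by (subst sums_Suc_iff) (use zeta_coeff_binomial_sums[OF assms, of j] in simp)
  then show ?thesis
    unfolding zeta_coeff_Suc
    using hurwitz_zeta_eq_Polygamma[OF one_minus_notin_nonpos_Ints[OF assms], of j]
    by (cases "j = 0") (simp_all add: zeta_coeff_def binomial_eq_0)
qed

theorem theorem10:
  fixes \<alpha> \<beta> r x :: complex and n :: nat
  assumes "\<beta> \<noteq> 0" and "norm x < 1"
  shows "(\<lambda>k. riemann_zeta (of_nat (Suc k) + 1) *
              gen_factorial (r + of_nat (Suc k) * \<beta>) \<alpha> n * x ^ Suc k)
         sums
         (- gen_factorial r \<alpha> n * (Digamma (1 - x) + euler_mascheroni) +
          (\<Sum>k=1..n. gen_stirling n k \<alpha> \<beta> r * fact k *
                      hurwitz_zeta (of_nat k + 1) (1 - x) * (\<beta> * x) ^ k))"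
proof -
  define c where "c j = gen_stirling n j \<alpha> \<beta> r * \<beta> ^ j * fact j" for j
  define s where "s j = (if j = 0 then - (Digamma (1 - x) + euler_mascheroni)
      else x ^ j * hurwitz_zeta (of_nat j + 1) (1 - x))" for j
  have "(\<lambda>k. \<Sum>j\<le>n. c j *
        (riemann_zeta (of_nat (Suc k) + 1) * of_nat (Suc k choose j) * x ^ Suc k)) sums
      (\<Sum>j\<le>n. c j * s j)"
    unfolding s_def by (intro sums_sum sums_mult riemann_zeta_binomial_sums assms)
  also have "(\<lambda>k. \<Sum>j\<le>n. c j *
        (riemann_zeta (of_nat (Suc k) + 1) * of_nat (Suc k choose j) * x ^ Suc k)) =
      (\<lambda>k. riemann_zeta (of_nat (Suc k) + 1) *
              gen_factorial (r + of_nat (Suc k) * \<beta>) \<alpha> n * x ^ Suc k)"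
    unfolding gen_factorial_eq_sum_binomial[OF assms(1)] c_def sum_distrib_left sum_distrib_right
    by (intro ext sum.cong refl) (simp only: mult_ac)
  \<comment> \<open>Only \<open>j = 0\<close> gives a digamma value; all other terms are Hurwitz
    zeta values.\<close>
  also have "(\<Sum>j\<le>n. c j * s j) = c 0 * s 0 + (\<Sum>j=1..n. c j * s j)"
    by (simp add: atMost_atLeast0 sum.atLeast_Suc_atMost)
  also have "c 0 * s 0 = - gen_factorial r \<alpha> n * (Digamma (1 - x) + euler_mascheroni)"
    using assms(1) by (simp add: c_def s_def gen_stirling_k_0 algebra_simps)
  also have "(\<Sum>j=1..n. c j * s j) =
      (\<Sum>k=1..n. gen_stirling n k \<alpha> \<beta> r * fact k *
                      hurwitz_zeta (of_nat k + 1) (1 - x) * (\<beta> * x) ^ k)"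
    by (intro sum.cong refl) (simp add: c_def s_def power_mult_distrib mult_ac)
  finally show ?thesis .
qed

end
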